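(* Let $\bar\gamma>0$ and let $\alpha\ge 0$, $\beta\ge 0$ satisfy $\alpha+\beta\le 1$. Let $\gamma$ be the instantaneous SNR of a normalized SOSF fading channel with parameters $(\alpha,\beta)$ and average SNR $\bar\gamma$. Then its cumulative distribution function is, for $\gamma>0$, $$F_{\gamma}(\gamma)=1-\int_{0}^{\infty}Q_1\!\left(\sqrt{\frac{2 \beta}{1-\beta-\alpha(1-x)}},\ \sqrt{\frac{2\gamma /\bar\gamma}{1-\beta-\alpha(1-x)}}\right)e^{-x}\,dx.$$
   Context: SOSF (second order scattering fading) channel: $S=\omega_0e^{j\phi}+\omega_1G_1+\omega_2G_2G_3$, where $j$ is the imaginary unit, $\omega_0,\omega_1,\omega_2\ge 0$ are real constants with $\omega_0^2+\omega_1^2+\omega_2^2=1$, $\phi$ is uniform on $[0,2\pi)$, and $G_1,G_2,G_3$ are circularly-symmetric complex Gaussian random variables with mean $0$ and variance $\mathbb{E}|G_i|^2=1$; $\phi,G_1,G_2,G_3$ are mutually independent. The parameters are $\alpha=\omega_2^2$ and $\beta=\omega_0^2$ (so $\omega_1^2=1-\alpha-\beta$). The instantaneous SNR is $\gamma=\bar\gamma|S|^2$, so that $\mathbb{E}(\gamma)=\bar\gamma$. $Q_1$ is the first-order Marcum Q-function, $Q_1(a,b)=\int_b^\infty t\,e^{-(t^2+a^2)/2}I_0(at)\,dt$ for $a,b\ge0$, with $I_0$ the modified Bessel function of the first kind of order zero.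
   Formalization: The point (α,β)=(0,1) is excluded: there 1−β−α(1−x)=0 for every x, so both arguments of Q_1 are divisions by zero and the formula is undefined. *)

theory Defs
  imports "HOL-Probability.Probability"
begin

definition bessel_I0 :: "real \<Rightarrow> real" where
  "bessel_I0 x = (\<Sum>k. (x / 2) ^ (2 * k) / (fact k)\<^sup>2)"

definition marcum_Q1 :: "real \<Rightarrow> real \<Rightarrow> real" where
  "marcum_Q1 a b = (LBINT t:{b..}. t * exp (- (t\<^sup>2 + a\<^sup>2) / 2) * bessel_I0 (a * t))"

(* Circularly-symmetric complex Gaussian with mean 0 and E|G|^2 = v > 0: real and imaginary
   parts are independent real Gaussians, each with mean 0 and variance v / 2 (the second
   argument of normal_density is a standard deviation). *)
definition circular_complex_gaussian :: "'a measure \<Rightarrow> ('a \<Rightarrow> complex) \<Rightarrow> real \<Rightarrow> bool" where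
  "circular_complex_gaussian M G v \<longleftrightarrow>
     prob_space.indep_var M borel (\<lambda>w. Re (G w)) borel (\<lambda>w. Im (G w)) \<and>
     distributed M lborel (\<lambda>w. Re (G w)) (\<lambda>x. ennreal (normal_density 0 (sqrt (v / 2)) x)) \<and>
     distributed M lborel (\<lambda>w. Im (G w)) (\<lambda>x. ennreal (normal_density 0 (sqrt (v / 2)) x))"

(* indep_vars needs a common codomain, so the real phase is embedded into the complex numbers;
   the embedding is a closed one, hence the generated sigma-algebra is that of the phase. *)
locale sosf_channel = prob_space M for M :: "'a measure" +
  fixes \<omega>0 \<omega>1 \<omega>2 :: real
    and \<phi> :: "'a \<Rightarrow> real"
    and G1 G2 G3 :: "'a \<Rightarrow> complex"
  assumes nonneg: "\<omega>0 \<ge> 0" "\<omega>1 \<ge> 0" "\<omega>2 \<ge> 0"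
    and normalized: "\<omega>0\<^sup>2 + \<omega>1\<^sup>2 + \<omega>2\<^sup>2 = 1"
    and phase_uniform:
      "distributed M lborel \<phi>
         (\<lambda>t. ennreal (indicator {0..<2 * pi} t / measure lborel {0..<2 * pi}))"
    and gaussian:
      "circular_complex_gaussian M G1 1"
      "circular_complex_gaussian M G2 1"
      "circular_complex_gaussian M G3 1"
    and independent:
      "indep_vars (\<lambda>_. borel) (\<lambda>i::nat. [\<lambda>w. complex_of_real (\<phi> w), G1, G2, G3] ! i) {..<4}"

definition sosf_S ::
  "real \<Rightarrow> real \<Rightarrow> real \<Rightarrow> ('a \<Rightarrow> real) \<Rightarrow> ('a \<Rightarrow> complex) \<Rightarrow> ('a \<Rightarrow> complex) \<Rightarrow> ('a \<Rightarrow> complex) \<Rightarrow>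
   'a \<Rightarrow> complex" where
  "sosf_S \<omega>0 \<omega>1 \<omega>2 \<phi> G1 G2 G3 w =
     of_real \<omega>0 * exp (\<i> * of_real (\<phi> w)) + of_real \<omega>1 * G1 w + of_real \<omega>2 * G2 w * G3 w"

definition sosf_snr ::
  "real \<Rightarrow> real \<Rightarrow> real \<Rightarrow> real \<Rightarrow> ('a \<Rightarrow> real) \<Rightarrow> ('a \<Rightarrow> complex) \<Rightarrow> ('a \<Rightarrow> complex) \<Rightarrow>
   ('a \<Rightarrow> complex) \<Rightarrow> 'a \<Rightarrow> real" where
  "sosf_snr \<gamma>bar \<omega>0 \<omega>1 \<omega>2 \<phi> G1 G2 G3 w = \<gamma>bar * (cmod (sosf_S \<omega>0 \<omega>1 \<omega>2 \<phi> G1 G2 G3 w))\<^sup>2"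

end

(* Conditionally on G3 the diffuse part w1 G1 + w2 G2 G3 is circular Gaussian with variance
   V = w1^2 + w2^2 |G3|^2, and |G3|^2 is exponential with mean 1. By circularity the phase of the
   specular component can be rotated away, so that |S|, given V, is Rice distributed; in polar
   coordinates the angular integral of its density is 2 pi I0, and the tail of the Rice law is a
   Marcum Q-function. Averaging over the exponential law of |G3|^2 gives the formula. *)

theory Submission
  imports Defs
begin

text \<open>Distributions are handled as nonnegative integrals of an arbitrary measurable integrand,
  so no integrability is carried along; \<open>marcum_Q1\<close>, a Bochner integral, is recovered
  only at the end, its finiteness coming from total mass 1. Changes of variables in the plane are
  composed of affine substitutions on the line and Tonelli. Hence the slope t replaces the polar
  angle, the radius carries a sign, and the angular integral becomes a series of integrals of (1 +
  t^2)^-(k+1), whose values turn the series of 2 cosh into that of I0. The pair (\<alpha>, \<beta>)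
  = (0, 1) has to be excluded: there |S| = 1 and V vanishes identically. With division by zero equal
  to 0 the right-hand side would read 1 - Q_1(0, 0) = 0, whereas the distribution function is 1 from
  the average SNR on.\<close>

section \<open>Rotations, polar coordinates and reflection for Lebesgue integrals\<close>

lemma nn_integral_lborel_pair_swap:
  fixes f :: "real \<times> real \<Rightarrow> ennreal"
  assumes [measurable]: "f \<in> borel_measurable (borel \<Otimes>\<^sub>M borel)"
  shows "(\<integral>\<^sup>+x. \<integral>\<^sup>+y. f (x, y) \<partial>lborel \<partial>lborel) = (\<integral>\<^sup>+y. \<integral>\<^sup>+x. f (x, y) \<partial>lborel \<partial>lborel)"
  by (rule lborel_pair.Fubini') simp

text \<open>A rotation with c nonzero splits into two one-variable substitutions. At fixed y the
  first coordinate becomes the new x, which by c^2 + s^2 = 1 turns the second into (s x + y) / c; at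
  fixed x a scaling of y by c then cancels the Jacobian. For c = 0 the map only swaps the
  coordinates, up to signs.\<close>

lemma nn_integral_lborel_rotate:
  fixes f :: "real \<times> real \<Rightarrow> ennreal"
  assumes f[measurable]: "f \<in> borel_measurable (borel \<Otimes>\<^sub>M borel)" and cs: "c\<^sup>2 + s\<^sup>2 = 1"
  shows "(\<integral>\<^sup>+x. \<integral>\<^sup>+y. f (c * x - s * y, s * x + c * y) \<partial>lborel \<partial>lborel) =
         (\<integral>\<^sup>+x. \<integral>\<^sup>+y. f (x, y) \<partial>lborel \<partial>lborel)"
proof (cases "c = 0")
  case True
  then have s: "\<bar>s\<bar> = 1" using cs by (auto simp: power2_eq_1_iff)
  then have s0: "s \<noteq> 0" by auto
  have "(\<integral>\<^sup>+x. \<integral>\<^sup>+y. f (x, y) \<partial>lborel \<partial>lborel) = (\<integral>\<^sup>+x. \<integral>\<^sup>+y. f (-s * x, y) \<partial>lborel \<partial>lborel)"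
    by (subst nn_integral_real_affine[where c="-s" and t=0]) (use s s0 in auto)
  also have "\<dots> = (\<integral>\<^sup>+x. \<integral>\<^sup>+y. f (-s * x, s * y) \<partial>lborel \<partial>lborel)"
  proof (rule nn_integral_cong)
    fix x
    show "(\<integral>\<^sup>+y. f (-s * x, y) \<partial>lborel) = (\<integral>\<^sup>+y. f (-s * x, s * y) \<partial>lborel)"
      using nn_integral_real_affine[of "\<lambda>y. f (- s * x, y)" s 0] s s0 by simp
  qed
  also have "\<dots> = (\<integral>\<^sup>+y. \<integral>\<^sup>+x. f (-s * x, s * y) \<partial>lborel \<partial>lborel)"
    using nn_integral_lborel_pair_swap[of "\<lambda>(x, y). f (-s * x, s * y)"] by simp
  finally show ?thesis using True by simp
next
  case False
  have "(\<integral>\<^sup>+x. \<integral>\<^sup>+y. f (c * x - s * y, s * x + c * y) \<partial>lborel \<partial>lborel) =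
        (\<integral>\<^sup>+y. \<integral>\<^sup>+x. f (c * x - s * y, s * x + c * y) \<partial>lborel \<partial>lborel)"
    using nn_integral_lborel_pair_swap[of "\<lambda>(x, y). f (c * x - s * y, s * x + c * y)"] by simp
  also have "\<dots> = (\<integral>\<^sup>+y. ennreal \<bar>1/c\<bar> * (\<integral>\<^sup>+x. f (x, (s * x + y) / c) \<partial>lborel) \<partial>lborel)"
  proof (intro nn_integral_cong)
    fix y
    have "s * (s * y / c + x / c) + c * y = (s * x + (c\<^sup>2 + s\<^sup>2) * y) / c" for x
      using False by (simp add: divide_simps) (simp add: power2_eq_square algebra_simps)
    then have *: "f (c * (s * y / c + 1 / c * x) - s * y, s * (s * y / c + 1 / c * x) + c * y) =
        f (x, (s * x + y) / c)" for x
      using cs False by (simp add: distrib_left)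
    show "(\<integral>\<^sup>+x. f (c * x - s * y, s * x + c * y) \<partial>lborel) =
        ennreal \<bar>1/c\<bar> * (\<integral>\<^sup>+x. f (x, (s * x + y) / c) \<partial>lborel)"
      using False
      by (subst nn_integral_real_affine[where c="1/c" and t="s * y / c"]) (simp_all only: *, simp_all)
  qed
  also have "\<dots> = (\<integral>\<^sup>+y. \<integral>\<^sup>+x. ennreal \<bar>1/c\<bar> * f (x, (s * x + y) / c) \<partial>lborel \<partial>lborel)"
    by (simp add: nn_integral_cmult)
  also have "\<dots> = (\<integral>\<^sup>+x. \<integral>\<^sup>+y. ennreal \<bar>1/c\<bar> * f (x, (s * x + y) / c) \<partial>lborel \<partial>lborel)"
    using nn_integral_lborel_pair_swap[of "\<lambda>(x, y). ennreal \<bar>1/c\<bar> * f (x, (s * x + y) / c)"] by simp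
  also have "\<dots> = (\<integral>\<^sup>+x. \<integral>\<^sup>+y. f (x, y) \<partial>lborel \<partial>lborel)"
  proof (rule nn_integral_cong)
    fix x
    show "(\<integral>\<^sup>+y. ennreal \<bar>1/c\<bar> * f (x, (s * x + y) / c) \<partial>lborel) = (\<integral>\<^sup>+y. f (x, y) \<partial>lborel)"
      using False
      by (subst (2) nn_integral_real_affine[where c="1/c" and t="s * x / c"])
         (simp_all add: nn_integral_cmult add_divide_distrib)
  qed
  finally show ?thesis .
qed

text \<open>Polar coordinates with the slope \<open>t = tan \<theta>\<close> instead of the angle, so that
  \<open>d\<theta> = dt / (1 + t\<^sup>2)\<close>; the radius \<open>r\<close> ranges over the whole line.\<close>

lemma nn_integral_lborel_polar:
  fixes f :: "real \<times> real \<Rightarrow> ennreal"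
  assumes f[measurable]: "f \<in> borel_measurable (borel \<Otimes>\<^sub>M borel)"
  shows "(\<integral>\<^sup>+x. \<integral>\<^sup>+y. f (x, y) \<partial>lborel \<partial>lborel) =
    (\<integral>\<^sup>+r. \<integral>\<^sup>+t. ennreal (\<bar>r\<bar> / (1 + t\<^sup>2)) * f (r / sqrt (1 + t\<^sup>2), r * t / sqrt (1 + t\<^sup>2)) \<partial>lborel \<partial>lborel)"
proof -
  \<comment> \<open>The weight is the product of |x| = |r| / sqrt (1 + t^2), from y = x t at fixed x
    (singular only on the null set x = 0), and 1 / sqrt (1 + t^2), from x = r / sqrt (1 + t^2) at
    fixed t. A slope determines a line and not a ray, so r takes both signs.\<close>
  have "(\<integral>\<^sup>+x. \<integral>\<^sup>+y. f (x, y) \<partial>lborel \<partial>lborel) = (\<integral>\<^sup>+x. \<integral>\<^sup>+t. ennreal \<bar>x\<bar> * f (x, x * t) \<partial>lborel \<partial>lborel)"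
  proof (intro nn_integral_cong_AE, use AE_lborel_singleton[of "0::real"] in eventually_elim)
    fix x :: real assume "x \<noteq> 0"
    then show "(\<integral>\<^sup>+y. f (x, y) \<partial>lborel) = (\<integral>\<^sup>+t. ennreal \<bar>x\<bar> * f (x, x * t) \<partial>lborel)"
      by (subst nn_integral_real_affine[where c=x and t=0]) (simp_all add: nn_integral_cmult)
  qed
  also have "\<dots> = (\<integral>\<^sup>+t. \<integral>\<^sup>+x. ennreal \<bar>x\<bar> * f (x, x * t) \<partial>lborel \<partial>lborel)"
    using nn_integral_lborel_pair_swap[of "\<lambda>(x, t). ennreal \<bar>x\<bar> * f (x, x * t)"] by simp
  also have "\<dots> = (\<integral>\<^sup>+t. \<integral>\<^sup>+r. ennreal (\<bar>r\<bar> / (1 + t\<^sup>2)) * f (r / sqrt (1 + t\<^sup>2), r * t / sqrt (1 + t\<^sup>2)) \<partial>lborel \<partial>lborel)"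
  proof (rule nn_integral_cong)
    fix t :: real
    have pos: "0 < 1 + t\<^sup>2" by (simp add: add_pos_nonneg)
    have *: "ennreal (1 / sqrt (1 + t\<^sup>2)) * (ennreal (\<bar>r\<bar> / sqrt (1 + t\<^sup>2)) * z) = ennreal (\<bar>r\<bar> / (1 + t\<^sup>2)) * z"
      for r z using pos by (simp add: mult.assoc[symmetric] ennreal_mult'[symmetric])
    show "(\<integral>\<^sup>+x. ennreal \<bar>x\<bar> * f (x, x * t) \<partial>lborel) =
      (\<integral>\<^sup>+r. ennreal (\<bar>r\<bar> / (1 + t\<^sup>2)) * f (r / sqrt (1 + t\<^sup>2), r * t / sqrt (1 + t\<^sup>2)) \<partial>lborel)"
      using pos by (subst nn_integral_real_affine[where c="1 / sqrt (1 + t\<^sup>2)" and t=0])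
        (simp_all add: nn_integral_cmult[symmetric] abs_divide * )
  qed
  also have "\<dots> = (\<integral>\<^sup>+r. \<integral>\<^sup>+t. ennreal (\<bar>r\<bar> / (1 + t\<^sup>2)) * f (r / sqrt (1 + t\<^sup>2), r * t / sqrt (1 + t\<^sup>2)) \<partial>lborel \<partial>lborel)"
    using nn_integral_lborel_pair_swap[of "\<lambda>(r, t). ennreal (\<bar>r\<bar> / (1 + t\<^sup>2)) * f (r / sqrt (1 + t\<^sup>2), r * t / sqrt (1 + t\<^sup>2))"] by simp
  finally show ?thesis .
qed

lemma polar_norm: "(r / sqrt (1 + t\<^sup>2))\<^sup>2 + (r * t / sqrt (1 + t\<^sup>2))\<^sup>2 = r\<^sup>2" for r t :: real
proof -
  have "1 + t\<^sup>2 > 0" by (simp add: add_pos_nonneg)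
  moreover have "(r / sqrt (1 + t\<^sup>2))\<^sup>2 + (r * t / sqrt (1 + t\<^sup>2))\<^sup>2 = r\<^sup>2 * (1 + t\<^sup>2) / (1 + t\<^sup>2)"
    by (simp add: power_divide power_mult_distrib add_divide_distrib distrib_left)
  ultimately show ?thesis by simp
qed

text \<open>This brings the signed radius of the polar formula back to the half-line. For integrands
  even in r it yields a factor 2; in the Rice computation it produces a pair of exponentials of
  opposite sign.\<close>

lemma nn_integral_lborel_fold:
  fixes f :: "real \<Rightarrow> ennreal"
  assumes [measurable]: "f \<in> borel_measurable borel"
  shows "(\<integral>\<^sup>+x. f x \<partial>lborel) = (\<integral>\<^sup>+x. (f x + f (- x)) * indicator {0..} x \<partial>lborel)"
proof -
  have "(\<integral>\<^sup>+x. f x \<partial>lborel) = (\<integral>\<^sup>+x. f x * indicator {0..} x + f x * indicator {..0} x \<partial>lborel)"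
    by (intro nn_integral_cong_AE, use AE_lborel_singleton[of "0::real"] in eventually_elim)
       (auto split: split_indicator)
  also have "\<dots> = (\<integral>\<^sup>+x. f x * indicator {0..} x \<partial>lborel) + (\<integral>\<^sup>+x. f x * indicator {..0} x \<partial>lborel)"
    by (rule nn_integral_add) auto
  also have "(\<integral>\<^sup>+x. f x * indicator {..0} x \<partial>lborel) = (\<integral>\<^sup>+x. f (- x) * indicator {0..} x \<partial>lborel)"
    by (subst nn_integral_real_affine[where c="-1" and t=0]) (auto simp: indicator_def)
  finally show ?thesis
    by (subst (asm) nn_integral_add[symmetric]) (auto simp: distrib_right)
qed

section \<open>Wallis integrals\<close>

text \<open>The integral of cos^(2k) over [-pi/2, pi/2], that is pi times the central binomial
  coefficient over 4^k; with t = tan of the angle the integrand is 1 / (1 + t^2)^(k+1).\<close>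

definition wallis :: "nat \<Rightarrow> real" where
  "wallis k = pi * fact (2 * k) / (4 ^ k * (fact k)\<^sup>2)"

lemma wallis_Suc: "wallis (Suc k) = (2 * k + 1) / (2 * k + 2) * wallis k"
  by (simp add: wallis_def power2_eq_square divide_simps) (simp add: algebra_simps)

text \<open>Reduction formula: with u = 1 + t^2, the derivative of t / u^(k+1) is (2k+2) / u^(k+2) -
  (2k+1) / u^(k+1). Solving for the first term gives the next antiderivative from the previous one,
  starting at arctan; the extra term t / u^(k+1) vanishes both at 0 and at infinity.\<close>

lemma wallis_antiderivative:
  "\<exists>F. (\<forall>t. (F has_real_derivative 1 / (1 + t\<^sup>2) ^ Suc k) (at t)) \<and> (F \<longlongrightarrow> wallis k / 2) at_top \<and> F 0 = 0"
proof (induction k)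
  case 0
  show ?case
    by (rule exI[of _ arctan])
       (auto intro!: derivative_eq_intros tendsto_arctan_at_top simp: wallis_def field_simps)
next
  case (Suc k)
  then obtain F where F: "\<And>t. (F has_real_derivative 1 / (1 + t\<^sup>2) ^ Suc k) (at t)"
    "(F \<longlongrightarrow> wallis k / 2) at_top" "F 0 = 0" by blast
  define G where "G = (\<lambda>t::real. ((2 * k + 1) * F t + t / (1 + t\<^sup>2) ^ Suc k) / (2 * k + 2))"
  have "(G has_real_derivative 1 / (1 + t\<^sup>2) ^ Suc (Suc k)) (at t)" for t
  proof -
    define u where "u = 1 + t\<^sup>2"
    have u: "u > 0" "t * t = u - 1" by (simp_all add: u_def add_pos_nonneg power2_eq_square)
    have e: "t * (Suc k * u ^ k * (2 * t)) = 2 * Suc k * (u - 1) * u ^ k"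
      unfolding u(2)[symmetric] by (simp only: mult_ac of_nat_mult of_nat_numeral)
    have "((\<lambda>t. (1 + t\<^sup>2) ^ Suc k) has_real_derivative (1 + of_nat k) * (2 * t * u ^ k)) (at t)"
      unfolding u_def by (rule DERIV_power_Suc) (auto intro!: derivative_eq_intros)
    then have "((\<lambda>t. t / (1 + t\<^sup>2) ^ Suc k) has_real_derivative
       (1 * u ^ Suc k - t * ((1 + of_nat k) * (2 * t * u ^ k))) / (u ^ Suc k * u ^ Suc k)) (at t)"
      using DERIV_divide[OF DERIV_ident, of "\<lambda>t. (1 + t\<^sup>2) ^ Suc k" _ t UNIV] u(1) by (simp add: u_def)
    then have "((\<lambda>t. t / (1 + t\<^sup>2) ^ Suc k) has_real_derivative
       (2 * Suc k) / u ^ Suc (Suc k) - (2 * k + 1) / u ^ Suc k) (at t)"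
    proof (rule DERIV_cong)
      have *: "t * ((1 + of_nat k) * (2 * t * u ^ k)) = 2 * Suc k * (u - 1) * u ^ k"
        using e by (simp add: mult_ac)
      show "(1 * u ^ Suc k - t * ((1 + of_nat k) * (2 * t * u ^ k))) / (u ^ Suc k * u ^ Suc k) =
        (2 * Suc k) / u ^ Suc (Suc k) - (2 * k + 1) / u ^ Suc k"
        unfolding * using u(1) by (simp add: divide_simps) (simp add: algebra_simps)
    qed
    from DERIV_cdivide[OF DERIV_add[OF DERIV_cmult[OF F(1), of "2 * k + 1"] this], of "2 * k + 2"]
    show ?thesis unfolding G_def u_def[symmetric]
      by (rule DERIV_cong) (use u in \<open>simp add: divide_simps\<close>)
  qed
  moreover have "(G \<longlongrightarrow> ((2 * k + 1) * (wallis k / 2) + 0) / (2 * k + 2)) at_top"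
  proof -
    have "((\<lambda>t::real. t / (1 + t\<^sup>2) ^ Suc k) \<longlongrightarrow> 0) at_top"
    proof (rule tendsto_sandwich[OF _ _ tendsto_const tendsto_inverse_0_at_top])
      show "\<forall>\<^sub>F t::real in at_top. t / (1 + t\<^sup>2) ^ Suc k \<le> inverse t"
      proof (use eventually_gt_at_top[of "0::real"] in eventually_elim)
        fix t :: real assume t: "t > 0"
        have "t\<^sup>2 \<le> (1 + t\<^sup>2) ^ Suc k"
          using self_le_power[of "1 + t\<^sup>2" "Suc k"] by simp
        then show "t / (1 + t\<^sup>2) ^ Suc k \<le> inverse t"
          using t by (simp add: field_simps power2_eq_square add_pos_pos)
      qed
    qed (auto intro: filterlim_ident eventually_mono[OF eventually_gt_at_top[of "0::real"]])
    then show ?thesis unfolding G_def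
      by (intro tendsto_intros F) auto
  qed
  moreover have "G 0 = 0" by (simp add: G_def F)
  ultimately show ?case
    by (intro exI[of _ G]) (auto simp: wallis_Suc field_simps)
qed

lemma nn_integral_wallis:
  "(\<integral>\<^sup>+t. ennreal (1 / (1 + t\<^sup>2) ^ Suc k) \<partial>lborel) = ennreal (wallis k)"
proof -
  obtain F where F: "\<And>t. (F has_real_derivative 1 / (1 + t\<^sup>2) ^ Suc k) (at t)"
    "(F \<longlongrightarrow> wallis k / 2) at_top" "F 0 = 0" using wallis_antiderivative by blast
  have "(\<integral>\<^sup>+t. ennreal (1 / (1 + t\<^sup>2) ^ Suc k) \<partial>lborel) =
        (\<integral>\<^sup>+t. 2 * (ennreal (1 / (1 + t\<^sup>2) ^ Suc k) * indicator {0..} t) \<partial>lborel)"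
    by (subst nn_integral_lborel_fold) (simp_all add: mult_2 distrib_right)
  also have "\<dots> = 2 * (\<integral>\<^sup>+t. ennreal (1 / (1 + t\<^sup>2) ^ Suc k) * indicator {0..} t \<partial>lborel)"
    by (rule nn_integral_cmult) simp
  also have "(\<integral>\<^sup>+t. ennreal (1 / (1 + t\<^sup>2) ^ Suc k) * indicator {0..} t \<partial>lborel) = ennreal (wallis k / 2 - F 0)"
    by (rule nn_integral_FTC_atLeast[OF _ F(1) _ F(2)]) auto
  also have "2 * \<dots> = ennreal (2 * (wallis k / 2 - F 0))"
    by (subst ennreal_mult') auto
  finally show ?thesis by (simp add: F)
qed

section \<open>The circular complex Gaussian law\<close>

text \<open>With variance 1/2 the density is exp(-x^2) / sqrt pi, so a pair has the radial density
  exp(-(x^2 + y^2)) / pi and E|z|^2 = 1.\<close>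

definition half_normal :: "real measure" where
  "half_normal = density lborel (\<lambda>x. ennreal (normal_density 0 (sqrt (1 / 2)) x))"

lemma prob_space_half_normal: "prob_space half_normal"
  unfolding half_normal_def by (rule prob_space_normal_density) simp

interpretation half_normal: prob_space half_normal
  by (rule prob_space_half_normal)

interpretation half_normal_pair: pair_prob_space half_normal half_normal ..

lemma sets_half_normal[measurable_cong, simp]: "sets half_normal = sets borel"
  by (simp add: half_normal_def)

lemma nn_integral_half_normal_pair:
  fixes f :: "real \<times> real \<Rightarrow> ennreal"
  assumes f[measurable]: "f \<in> borel_measurable (borel \<Otimes>\<^sub>M borel)"
  shows "(\<integral>\<^sup>+x. \<integral>\<^sup>+y. f (x, y) \<partial>half_normal \<partial>half_normal) =
    (\<integral>\<^sup>+x. \<integral>\<^sup>+y. ennreal (exp (- (x\<^sup>2 + y\<^sup>2)) / pi) * f (x, y) \<partial>lborel \<partial>lborel)"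
proof -
  have "exp (- x\<^sup>2) / sqrt pi * (exp (- y\<^sup>2) / sqrt pi) = exp (- (x\<^sup>2 + y\<^sup>2)) / pi" for x y :: real
    by (simp add: exp_add[symmetric] add.commute)
  then have *: "ennreal (exp (- x\<^sup>2) / sqrt pi) * (ennreal (exp (- y\<^sup>2) / sqrt pi) * z) =
      ennreal (exp (- (x\<^sup>2 + y\<^sup>2)) / pi) * z" for x y z
    by (subst mult.assoc[symmetric], subst ennreal_mult'[symmetric]) simp_all
  show ?thesis
    unfolding half_normal_def
    by (simp add: nn_integral_density nn_integral_cmult[symmetric] normal_density_def * )
qed

lemma nn_integral_half_normal_rotate:
  fixes f :: "real \<times> real \<Rightarrow> ennreal"
  assumes f[measurable]: "f \<in> borel_measurable (borel \<Otimes>\<^sub>M borel)" and cs: "c\<^sup>2 + s\<^sup>2 = 1"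
  shows "(\<integral>\<^sup>+x. \<integral>\<^sup>+y. f (c * x - s * y, s * x + c * y) \<partial>half_normal \<partial>half_normal) =
         (\<integral>\<^sup>+x. \<integral>\<^sup>+y. f (x, y) \<partial>half_normal \<partial>half_normal)"
proof -
  have "(c * x - s * y)\<^sup>2 + (s * x + c * y)\<^sup>2 = (c\<^sup>2 + s\<^sup>2) * (x\<^sup>2 + y\<^sup>2)" for x y
    by (simp add: power2_eq_square algebra_simps)
  then have e: "(c * x - s * y)\<^sup>2 + (s * x + c * y)\<^sup>2 = x\<^sup>2 + y\<^sup>2" for x y
    using cs by simp
  have "(\<integral>\<^sup>+x. \<integral>\<^sup>+y. f (c * x - s * y, s * x + c * y) \<partial>half_normal \<partial>half_normal) =
    (\<integral>\<^sup>+x. \<integral>\<^sup>+y. ennreal (exp (- (x\<^sup>2 + y\<^sup>2)) / pi) * f (c * x - s * y, s * x + c * y) \<partial>lborel \<partial>lborel)"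
    using nn_integral_half_normal_pair[of "\<lambda>(x, y). f (c * x - s * y, s * x + c * y)"] by simp
  also have "\<dots> = (\<integral>\<^sup>+x. \<integral>\<^sup>+y. ennreal (exp (- (x\<^sup>2 + y\<^sup>2)) / pi) * f (x, y) \<partial>lborel \<partial>lborel)"
    using nn_integral_lborel_rotate[of "\<lambda>(x, y). ennreal (exp (- (x\<^sup>2 + y\<^sup>2)) / pi) * f (x, y)", OF _ cs]
    by (simp add: e del: minus_add_distrib)
  finally show ?thesis
    by (simp add: nn_integral_half_normal_pair)
qed

definition std_complex_normal :: "complex measure" where
  "std_complex_normal = distr (half_normal \<Otimes>\<^sub>M half_normal) borel (\<lambda>(x, y). Complex x y)"

lemma measurable_Complex[measurable]:
  assumes [measurable]: "f \<in> borel_measurable M" "g \<in> borel_measurable M"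
  shows "(\<lambda>x. Complex (f x) (g x)) \<in> borel_measurable M"
  by (simp add: borel_measurable_complex_iff)

lemma sets_std_complex_normal[measurable_cong, simp]: "sets std_complex_normal = sets borel"
  by (simp add: std_complex_normal_def)

lemma prob_space_std_complex_normal: "prob_space std_complex_normal"
  unfolding std_complex_normal_def by (rule half_normal_pair.prob_space_distr) measurable

interpretation std_complex_normal: prob_space std_complex_normal
  by (rule prob_space_std_complex_normal)

lemma nn_integral_std_complex_normal:
  fixes f :: "complex \<Rightarrow> ennreal"
  assumes [measurable]: "f \<in> borel_measurable borel"
  shows "(\<integral>\<^sup>+z. f z \<partial>std_complex_normal) = (\<integral>\<^sup>+x. \<integral>\<^sup>+y. f (Complex x y) \<partial>half_normal \<partial>half_normal)"
proof -
  have "(\<integral>\<^sup>+z. f z \<partial>std_complex_normal) = (\<integral>\<^sup>+p. f (Complex (fst p) (snd p)) \<partial>(half_normal \<Otimes>\<^sub>M half_normal))"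
    unfolding std_complex_normal_def by (subst nn_integral_distr) (auto simp: case_prod_beta')
  then show ?thesis
    by (subst (asm) half_normal.nn_integral_fst[symmetric]) auto
qed

lemma nn_integral_std_complex_normal_rotate:
  fixes f :: "complex \<Rightarrow> ennreal"
  assumes [measurable]: "f \<in> borel_measurable borel" and u: "cmod u = 1"
  shows "(\<integral>\<^sup>+z. f (u * z) \<partial>std_complex_normal) = (\<integral>\<^sup>+z. f z \<partial>std_complex_normal)"
proof -
  have "u * Complex x y = Complex (Re u * x - Im u * y) (Im u * x + Re u * y)" for x y
    by (simp add: complex_eq_iff)
  moreover have "(Re u)\<^sup>2 + (Im u)\<^sup>2 = 1"
    using u by (simp add: cmod_def)
  ultimately show ?thesis
    using nn_integral_half_normal_rotate[of "\<lambda>(x, y). f (Complex x y)" "Re u" "Im u"]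
    by (simp add: nn_integral_std_complex_normal)
qed

text \<open>The unimodular factor \<open>sgn a\<close> of a is absorbed by circular symmetry,
  leaving only the modulus; a = 0 has no such factor and is treated apart.\<close>

lemma nn_integral_std_complex_normal_mult:
  fixes f :: "complex \<Rightarrow> ennreal"
  assumes [measurable]: "f \<in> borel_measurable borel"
  shows "(\<integral>\<^sup>+z. f (a * z) \<partial>std_complex_normal) = (\<integral>\<^sup>+z. f (of_real (cmod a) * z) \<partial>std_complex_normal)"
proof (cases "a = 0")
  case False
  then have "cmod (sgn a) = 1" by (simp add: norm_sgn)
  from nn_integral_std_complex_normal_rotate[OF _ this, of "\<lambda>z. f (of_real (cmod a) * z)"]
  show ?thesis
    using False by (simp add: mult.assoc[symmetric] sgn_eq)
qed simp

text \<open>The sum of two independent circular Gaussians is a single one, by a rotation in the plane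
  spanned by the two real parts and a rotation in the plane spanned by the two imaginary parts.\<close>

lemma nn_integral_std_complex_normal_add_real:
  fixes f :: "complex \<Rightarrow> ennreal" and a b :: real
  assumes [measurable]: "f \<in> borel_measurable borel"
  shows "(\<integral>\<^sup>+z. \<integral>\<^sup>+w. f (of_real a * z + of_real b * w) \<partial>std_complex_normal \<partial>std_complex_normal) =
         (\<integral>\<^sup>+z. f (of_real (sqrt (a\<^sup>2 + b\<^sup>2)) * z) \<partial>std_complex_normal)"
proof (cases "a = 0 \<and> b = 0")
  case False
  define \<rho> where "\<rho> = sqrt (a\<^sup>2 + b\<^sup>2)"
  have \<rho>: "\<rho> > 0" "\<rho>\<^sup>2 = a\<^sup>2 + b\<^sup>2"
    using False by (auto simp: \<rho>_def sum_power2_gt_zero_iff)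
  \<comment> \<open>The sign of s makes a x1 + b x2 = \<rho> (c x1 - s x2), which is the first
    coordinate of the rotation lemma.\<close>
  define c s where "c = a / \<rho>" and "s = - b / \<rho>"
  have cs: "c\<^sup>2 + s\<^sup>2 = 1"
    using \<rho> False by (simp add: c_def s_def power_divide add_divide_distrib[symmetric] sum_power2_eq_zero_iff)
  have ab: "a = \<rho> * c" "b = - \<rho> * s"
    using \<rho> by (simp_all add: c_def s_def)
  let ?g = "\<lambda>x1 x2 y1 y2. f (Complex (\<rho> * (c * x1 - s * x2)) (\<rho> * (c * y1 - s * y2)))"
  have "(\<integral>\<^sup>+z. \<integral>\<^sup>+w. f (of_real a * z + of_real b * w) \<partial>std_complex_normal \<partial>std_complex_normal) =
    (\<integral>\<^sup>+x1. \<integral>\<^sup>+y1. \<integral>\<^sup>+x2. \<integral>\<^sup>+y2. ?g x1 x2 y1 y2 \<partial>half_normal \<partial>half_normal \<partial>half_normal \<partial>half_normal)"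
  proof -
    have "of_real a * Complex x1 y1 + of_real b * Complex x2 y2 =
      Complex (\<rho> * (c * x1 - s * x2)) (\<rho> * (c * y1 - s * y2))" for x1 x2 y1 y2
      by (simp add: complex_eq_iff ab algebra_simps)
    then show ?thesis by (simp add: nn_integral_std_complex_normal)
  qed
  \<comment> \<open>Exchanging y1 and x2 makes the two real parts adjacent, and likewise the two
    imaginary parts. Each rotated integrand depends on the first coordinate alone, so the other
    variable integrates to 1.\<close>
  also have "\<dots> = (\<integral>\<^sup>+x1. \<integral>\<^sup>+x2. \<integral>\<^sup>+y1. \<integral>\<^sup>+y2. ?g x1 x2 y1 y2 \<partial>half_normal \<partial>half_normal \<partial>half_normal \<partial>half_normal)"
    by (rule nn_integral_cong, rule half_normal_pair.Fubini') measurable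
  also have "\<dots> = (\<integral>\<^sup>+x1. \<integral>\<^sup>+x2. \<integral>\<^sup>+y1. \<integral>\<^sup>+y2. f (Complex (\<rho> * (c * x1 - s * x2)) (\<rho> * y1))
      \<partial>half_normal \<partial>half_normal \<partial>half_normal \<partial>half_normal)"
    using nn_integral_half_normal_rotate[OF _ cs, of "\<lambda>(y1, y2). f (Complex (\<rho> * (c * _ - s * _)) (\<rho> * y1))"]
    by simp
  also have "\<dots> = (\<integral>\<^sup>+x1. \<integral>\<^sup>+x2. \<integral>\<^sup>+y1. f (Complex (\<rho> * (c * x1 - s * x2)) (\<rho> * y1))
      \<partial>half_normal \<partial>half_normal \<partial>half_normal)"
    by (simp add: half_normal.emeasure_space_1)
  also have "\<dots> = (\<integral>\<^sup>+x1. \<integral>\<^sup>+x2. \<integral>\<^sup>+y1. f (Complex (\<rho> * x1) (\<rho> * y1)) \<partial>half_normal \<partial>half_normal \<partial>half_normal)"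
    using nn_integral_half_normal_rotate[OF _ cs, of "\<lambda>(x1, x2). \<integral>\<^sup>+y1. f (Complex (\<rho> * x1) (\<rho> * y1)) \<partial>half_normal"]
    by simp
  also have "\<dots> = (\<integral>\<^sup>+x1. \<integral>\<^sup>+y1. f (Complex (\<rho> * x1) (\<rho> * y1)) \<partial>half_normal \<partial>half_normal)"
    by (simp add: half_normal.emeasure_space_1)
  also have "\<dots> = (\<integral>\<^sup>+z. f (of_real \<rho> * z) \<partial>std_complex_normal)"
  proof -
    have "of_real \<rho> * Complex x y = Complex (\<rho> * x) (\<rho> * y)" for x y by (simp add: complex_eq_iff)
    then show ?thesis by (simp add: nn_integral_std_complex_normal)
  qed
  finally show ?thesis unfolding \<rho>_def .
qed (simp add: std_complex_normal.emeasure_space_1)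

text \<open>The complex factor b is first replaced by its modulus. With b = \<omega>2 g3 this is
  what produces the conditional variance \<omega>1^2 + \<omega>2^2 |g3|^2.\<close>

lemma nn_integral_std_complex_normal_add:
  fixes f :: "complex \<Rightarrow> ennreal"
  assumes [measurable]: "f \<in> borel_measurable borel"
  shows "(\<integral>\<^sup>+z. \<integral>\<^sup>+w. f (of_real a * z + b * w) \<partial>std_complex_normal \<partial>std_complex_normal) =
         (\<integral>\<^sup>+z. f (of_real (sqrt (a\<^sup>2 + (cmod b)\<^sup>2)) * z) \<partial>std_complex_normal)"
  using nn_integral_std_complex_normal_mult[of "\<lambda>w. f (of_real a * _ + w)" b]
    nn_integral_std_complex_normal_add_real[of f a "cmod b"]
  by simp

text \<open>In polar coordinates the angular integral \<open>wallis 0\<close> = pi cancels the 1 /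
  pi of the density, and the remaining 2 r exp(-r^2) has the antiderivative -exp(-r^2).\<close>

lemma std_complex_normal_norm_exponential:
  "distributed std_complex_normal lborel (\<lambda>z. (cmod z)\<^sup>2) (exponential_density 1)"
proof (rule exponential_distributedI)
  fix a :: real assume a: "0 \<le> a"
  have "emeasure std_complex_normal {z \<in> space std_complex_normal. (cmod z)\<^sup>2 \<le> a} =
    (\<integral>\<^sup>+z. indicator {z \<in> space std_complex_normal. (cmod z)\<^sup>2 \<le> a} z \<partial>std_complex_normal)"
    by (rule nn_integral_indicator[symmetric]) measurable
  also have "\<dots> = (\<integral>\<^sup>+z. indicator {..a} ((cmod z)\<^sup>2) \<partial>std_complex_normal)"
    by (intro nn_integral_cong) (auto split: split_indicator)
  also have "\<dots> = (\<integral>\<^sup>+x. \<integral>\<^sup>+y. indicator {..a} (x\<^sup>2 + y\<^sup>2) \<partial>half_normal \<partial>half_normal)"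
    by (simp add: nn_integral_std_complex_normal cmod_def)
  also have "\<dots> = (\<integral>\<^sup>+x. \<integral>\<^sup>+y. ennreal (exp (- (x\<^sup>2 + y\<^sup>2)) / pi) * indicator {..a} (x\<^sup>2 + y\<^sup>2) \<partial>lborel \<partial>lborel)"
    using nn_integral_half_normal_pair[of "\<lambda>(x, y). indicator {..a} (x\<^sup>2 + y\<^sup>2)"] by simp
  also have "\<dots> = (\<integral>\<^sup>+r. \<integral>\<^sup>+t. ennreal (\<bar>r\<bar> / (1 + t\<^sup>2)) * (ennreal (exp (- r\<^sup>2) / pi) * indicator {..a} (r\<^sup>2)) \<partial>lborel \<partial>lborel)"
    using nn_integral_lborel_polar[of "\<lambda>(x, y). ennreal (exp (- (x\<^sup>2 + y\<^sup>2)) / pi) * indicator {..a} (x\<^sup>2 + y\<^sup>2)"]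
    by (simp add: polar_norm del: minus_add_distrib)
  also have "\<dots> = (\<integral>\<^sup>+r. ennreal (\<bar>r\<bar> * exp (- r\<^sup>2)) * indicator {..a} (r\<^sup>2) \<partial>lborel)"
  proof (rule nn_integral_cong)
    fix r :: real
    have "(\<integral>\<^sup>+t. ennreal (\<bar>r\<bar> / (1 + t\<^sup>2)) * (ennreal (exp (- r\<^sup>2) / pi) * indicator {..a} (r\<^sup>2)) \<partial>lborel) =
      (\<integral>\<^sup>+t. (ennreal (\<bar>r\<bar> * exp (- r\<^sup>2) / pi) * indicator {..a} (r\<^sup>2)) * ennreal (1 / (1 + t\<^sup>2) ^ Suc 0) \<partial>lborel)"
      by (intro nn_integral_cong) (auto simp: ennreal_mult'[symmetric] split: split_indicator)
    also have "\<dots> = (ennreal (\<bar>r\<bar> * exp (- r\<^sup>2) / pi) * indicator {..a} (r\<^sup>2)) * ennreal (wallis 0)"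
      by (subst nn_integral_cmult) (simp_all only: nn_integral_wallis, simp)
    also have "\<dots> = ennreal (\<bar>r\<bar> * exp (- r\<^sup>2)) * indicator {..a} (r\<^sup>2)"
      by (auto simp: ennreal_mult'[symmetric] wallis_def split: split_indicator)
    finally show "(\<integral>\<^sup>+t. ennreal (\<bar>r\<bar> / (1 + t\<^sup>2)) * (ennreal (exp (- r\<^sup>2) / pi) * indicator {..a} (r\<^sup>2)) \<partial>lborel) =
       ennreal (\<bar>r\<bar> * exp (- r\<^sup>2)) * indicator {..a} (r\<^sup>2)" .
  qed
  also have "\<dots> = (\<integral>\<^sup>+r. ennreal (2 * r * exp (- r\<^sup>2)) * indicator {0..sqrt a} r \<partial>lborel)"
  proof -
    \<comment> \<open>This equivalence needs a nonnegative r, hence the folding first; the folding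
      also supplies the factor 2.\<close>
    have "(r\<^sup>2 \<le> a) = (r \<le> sqrt a)" if "0 \<le> r" for r
      using that a by (metis real_sqrt_le_iff real_sqrt_unique)
    then show ?thesis
      by (subst nn_integral_lborel_fold)
         (auto intro!: nn_integral_cong simp: ennreal_plus[symmetric] simp del: ennreal_plus split: split_indicator)
  qed
  also have "\<dots> = ennreal (- exp (- (sqrt a)\<^sup>2) - - exp (- 0\<^sup>2))"
    using a by (intro nn_integral_FTC_Icc) (auto intro!: derivative_eq_intros)
  also have "\<dots> = 1 - ennreal (exp (- a * 1))"
    using a by (simp add: ennreal_minus ennreal_1[symmetric] del: ennreal_1)
  finally show "emeasure std_complex_normal {z \<in> space std_complex_normal. (cmod z)\<^sup>2 \<le> a} = 1 - ennreal (exp (- a * 1))" .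
qed simp_all

section \<open>The Bessel function I0\<close>

text \<open>Since (k!)^2 is at least k!, the exponential series at (x/2)^2 dominates.\<close>

lemma summable_bessel_I0: "summable (\<lambda>k. (x / 2) ^ (2 * k) / (fact k)\<^sup>2 :: real)"
proof (rule summable_comparison_test'[OF summable_exp[of "(x / 2)\<^sup>2"]])
  fix k :: nat
  have "((x / 2)\<^sup>2) ^ k / (fact k)\<^sup>2 \<le> ((x / 2)\<^sup>2) ^ k / (fact k :: real)"
    by (intro divide_left_mono self_le_power) auto
  moreover have "norm ((x / 2) ^ (2 * k) / (fact k)\<^sup>2) = ((x / 2)\<^sup>2) ^ k / (fact k)\<^sup>2"
    unfolding power_mult real_norm_def by (intro abs_of_nonneg divide_nonneg_nonneg) auto
  ultimately show "norm ((x / 2) ^ (2 * k) / (fact k)\<^sup>2) \<le> inverse (fact k) * ((x / 2)\<^sup>2) ^ k"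
    by (simp only: divide_inverse mult.commute)
qed

lemma bessel_I0_nonneg: "bessel_I0 x \<ge> 0"
  unfolding bessel_I0_def by (intro suminf_nonneg summable_bessel_I0) (simp add: power_mult)

lemma measurable_bessel_I0[measurable]: "bessel_I0 \<in> borel_measurable borel"
  unfolding bessel_I0_def by measurable

lemma cosh_sums_even: "(\<lambda>k. x ^ (2 * k) / fact (2 * k)) sums cosh (x :: real)"
proof -
  \<comment> \<open>Reindexing along k -> 2k discards only the vanishing odd terms.\<close>
  have "(\<lambda>k. (\<lambda>n. if even n then x ^ n /\<^sub>R fact n else 0) (2 * k)) sums cosh x"
    by (subst sums_mono_reindex) (use cosh_converges[of x] in \<open>auto simp: strict_mono_def elim!: evenE\<close>)
  then show ?thesis by (simp add: field_simps)
qed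

text \<open>\<open>1 / sqrt (1 + t\<^sup>2)\<close> is the cosine of the polar angle, so this is the integral representation
  of the Bessel function, obtained by expanding the hyperbolic cosine.\<close>

lemma nn_integral_bessel_I0:
  "(\<integral>\<^sup>+t. ennreal ((exp (z / sqrt (1 + t\<^sup>2)) + exp (- (z / sqrt (1 + t\<^sup>2)))) / (1 + t\<^sup>2)) \<partial>lborel) =
   ennreal (2 * pi * bessel_I0 z)"
proof -
  \<comment> \<open>These are the coefficients of 2 cosh: only even powers survive, so every term is
    nonnegative even for z < 0 and the sum may be exchanged with the integral. The factor 1 / (1 +
    t^2) raises the exponent from k to k + 1.\<close>
  define c where "c = (\<lambda>k::nat. 2 * z ^ (2 * k) / fact (2 * k))"
  have c: "c k \<ge> 0" for k by (simp add: c_def power_mult)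
  have "ennreal ((exp (z / sqrt (1 + t\<^sup>2)) + exp (- (z / sqrt (1 + t\<^sup>2)))) / (1 + t\<^sup>2)) =
    (\<Sum>k. ennreal (c k * (1 / (1 + t\<^sup>2) ^ Suc k)))" for t
  proof (rule suminf_ennreal_eq[symmetric])
    have pos: "1 + t\<^sup>2 > 0" by (simp add: add_pos_nonneg)
    show "0 \<le> c k * (1 / (1 + t\<^sup>2) ^ Suc k)" for k
      using pos c[of k] by (intro mult_nonneg_nonneg) auto
    have "2 * ((z / sqrt (1 + t\<^sup>2)) ^ (2 * k) / fact (2 * k)) / (1 + t\<^sup>2) = c k * (1 / (1 + t\<^sup>2) ^ Suc k)" for k
    proof -
      have "sqrt (1 + t\<^sup>2) ^ (2 * k) = (1 + t\<^sup>2) ^ k"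
        using pos by (simp add: power_mult)
      then show ?thesis by (simp add: c_def power_divide mult.commute)
    qed
    moreover have "(\<lambda>k. 2 * ((z / sqrt (1 + t\<^sup>2)) ^ (2 * k) / fact (2 * k)) / (1 + t\<^sup>2)) sums
        (2 * cosh (z / sqrt (1 + t\<^sup>2)) / (1 + t\<^sup>2))"
      by (intro sums_divide sums_mult cosh_sums_even)
    moreover have "2 * cosh u = exp u + exp (- u)" for u :: real
      by (simp add: cosh_def)
    ultimately show "(\<lambda>k. c k * (1 / (1 + t\<^sup>2) ^ Suc k)) sums
        ((exp (z / sqrt (1 + t\<^sup>2)) + exp (- (z / sqrt (1 + t\<^sup>2)))) / (1 + t\<^sup>2))"
      by (simp only:)
  qed
  then have "(\<integral>\<^sup>+t. ennreal ((exp (z / sqrt (1 + t\<^sup>2)) + exp (- (z / sqrt (1 + t\<^sup>2)))) / (1 + t\<^sup>2)) \<partial>lborel) =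
     (\<Sum>k. \<integral>\<^sup>+t. ennreal (c k * (1 / (1 + t\<^sup>2) ^ Suc k)) \<partial>lborel)"
    by (simp add: nn_integral_suminf)
  also have "\<dots> = (\<Sum>k. ennreal (c k) * ennreal (wallis k))"
  proof (rule suminf_cong)
    fix k
    have "(\<integral>\<^sup>+t. ennreal (c k * (1 / (1 + t\<^sup>2) ^ Suc k)) \<partial>lborel) =
      (\<integral>\<^sup>+t. ennreal (c k) * ennreal (1 / (1 + t\<^sup>2) ^ Suc k) \<partial>lborel)"
      using c by (intro nn_integral_cong ennreal_mult') auto
    also have "\<dots> = ennreal (c k) * ennreal (wallis k)"
      by (subst nn_integral_cmult) (simp_all only: nn_integral_wallis, simp)
    finally show "(\<integral>\<^sup>+t. ennreal (c k * (1 / (1 + t\<^sup>2) ^ Suc k)) \<partial>lborel) = ennreal (c k) * ennreal (wallis k)" .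
  qed
  also have "\<dots> = (\<Sum>k. ennreal (2 * pi * ((z / 2) ^ (2 * k) / (fact k)\<^sup>2)))"
  proof (rule suminf_cong)
    fix k
    \<comment> \<open>The factorial of 2k cancels, and 4^k in the Wallis value turns z into z /
      2.\<close>
    have "c k * wallis k = 2 * pi * ((z / 2) ^ (2 * k) / (fact k)\<^sup>2)"
      by (simp add: c_def wallis_def power_divide power_mult)
    then show "ennreal (c k) * ennreal (wallis k) = ennreal (2 * pi * ((z / 2) ^ (2 * k) / (fact k)\<^sup>2))"
      using c[of k] by (simp add: ennreal_mult'[symmetric])
  qed
  also have "\<dots> = ennreal (2 * pi * bessel_I0 z)"
    unfolding bessel_I0_def
    by (intro suminf_ennreal_eq sums_mult summable_sums summable_bessel_I0) (simp add: power_mult)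
  finally show ?thesis .
qed

section \<open>Rice law and Marcum Q-function\<close>

text \<open>Scaling by sqrt (2 / V) turns w + sqrt V z into a planar Gaussian with unit variance per
  coordinate and mean (a, 0). This is the origin of a = sqrt (2 w^2 / V), and of V / 2 in front of
  r^2.\<close>

lemma nn_integral_rice:
  fixes h :: "real \<Rightarrow> ennreal"
  assumes [measurable]: "h \<in> borel_measurable borel" and V: "V > 0" and w: "w \<ge> 0"
  defines "a \<equiv> sqrt (2 * w\<^sup>2 / V)"
  shows "(\<integral>\<^sup>+z. h ((cmod (of_real w + of_real (sqrt V) * z))\<^sup>2) \<partial>std_complex_normal) =
    (\<integral>\<^sup>+r. ennreal (r * exp (- (r\<^sup>2 + a\<^sup>2) / 2) * bessel_I0 (a * r)) * h (V / 2 * r\<^sup>2) * indicator {0..} r \<partial>lborel)"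
proof -
  have a: "a = sqrt 2 * w / sqrt V"
    using w V by (simp add: a_def real_sqrt_mult real_sqrt_divide)
  let ?k = "\<lambda>x y. exp (- (((x - a)\<^sup>2 + y\<^sup>2) / 2)) / (2 * pi)"
  let ?s = "1 / sqrt 2"
  have "(\<integral>\<^sup>+z. h ((cmod (of_real w + of_real (sqrt V) * z))\<^sup>2) \<partial>std_complex_normal) =
    (\<integral>\<^sup>+x. \<integral>\<^sup>+y. h ((w + sqrt V * x)\<^sup>2 + (sqrt V * y)\<^sup>2) \<partial>half_normal \<partial>half_normal)"
    by (simp add: nn_integral_std_complex_normal cmod_def)
  also have "\<dots> = (\<integral>\<^sup>+x. \<integral>\<^sup>+y. ennreal (exp (- (x\<^sup>2 + y\<^sup>2)) / pi) * h ((w + sqrt V * x)\<^sup>2 + (sqrt V * y)\<^sup>2) \<partial>lborel \<partial>lborel)"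
    using nn_integral_half_normal_pair[of "\<lambda>(x, y). h ((w + sqrt V * x)\<^sup>2 + (sqrt V * y)\<^sup>2)"] by simp
  \<comment> \<open>Both coordinates are scaled by 1 / sqrt 2, the first being also shifted by the
    mean. The two Jacobians together turn 1 / pi into 1 / (2 pi).\<close>
  also have "\<dots> = ennreal ?s * (\<integral>\<^sup>+x. \<integral>\<^sup>+y. ennreal (exp (- ((?s * (x - a))\<^sup>2 + y\<^sup>2)) / pi) *
      h ((sqrt V * ?s * x)\<^sup>2 + (sqrt V * y)\<^sup>2) \<partial>lborel \<partial>lborel)"
  proof -
    have "- a * ?s + ?s * x = ?s * (x - a)" "w + sqrt V * (?s * (x - a)) = sqrt V * ?s * x" for x
      using V by (simp_all add: a field_simps)
    then show ?thesis
      by (subst nn_integral_real_affine[where c="?s" and t="- a * ?s"]) (simp_all only:, simp_all)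
  qed
  also have "\<dots> = ennreal ?s * (\<integral>\<^sup>+x. ennreal ?s * (\<integral>\<^sup>+y. ennreal (exp (- ((?s * (x - a))\<^sup>2 + (?s * y)\<^sup>2)) / pi) *
      h ((sqrt V * ?s * x)\<^sup>2 + (sqrt V * ?s * y)\<^sup>2) \<partial>lborel) \<partial>lborel)"
  proof -
    have "(\<integral>\<^sup>+y. ennreal (exp (- ((?s * (x - a))\<^sup>2 + y\<^sup>2)) / pi) * h ((sqrt V * ?s * x)\<^sup>2 + (sqrt V * y)\<^sup>2) \<partial>lborel) =
      ennreal ?s * (\<integral>\<^sup>+y. ennreal (exp (- ((?s * (x - a))\<^sup>2 + (?s * y)\<^sup>2)) / pi) *
      h ((sqrt V * ?s * x)\<^sup>2 + (sqrt V * ?s * y)\<^sup>2) \<partial>lborel)" for x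
      by (subst nn_integral_real_affine[where c="?s" and t=0]) (simp_all add: mult.assoc)
    then show ?thesis by simp
  qed
  also have "\<dots> = (\<integral>\<^sup>+x. \<integral>\<^sup>+y. ennreal (?k x y) * h (V / 2 * (x\<^sup>2 + y\<^sup>2)) \<partial>lborel \<partial>lborel)"
  proof -
    have e: "(?s * (x - a))\<^sup>2 + (?s * y)\<^sup>2 = ((x - a)\<^sup>2 + y\<^sup>2) / 2"
      "(sqrt V * ?s * x)\<^sup>2 + (sqrt V * ?s * y)\<^sup>2 = V / 2 * (x\<^sup>2 + y\<^sup>2)" for x y
      using V by (simp_all add: power_mult_distrib power_divide field_simps)
    have f: "ennreal ?s * (ennreal ?s * (ennreal (u / pi) * v)) = ennreal (u / (2 * pi)) * v" if "u \<ge> 0" for u v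
      using that by (simp add: mult.assoc[symmetric] ennreal_mult'[symmetric])
    show ?thesis
      unfolding e by (subst nn_integral_cmult[symmetric], simp)+ (simp add: f)
  qed
  also have "\<dots> = (\<integral>\<^sup>+r. \<integral>\<^sup>+t. ennreal (\<bar>r\<bar> / (1 + t\<^sup>2)) * (ennreal (?k (r / sqrt (1 + t\<^sup>2)) (r * t / sqrt (1 + t\<^sup>2))) *
      h (V / 2 * r\<^sup>2)) \<partial>lborel \<partial>lborel)"
    using nn_integral_lborel_polar[of "\<lambda>(x, y). ennreal (?k x y) * h (V / 2 * (x\<^sup>2 + y\<^sup>2))"]
    by (simp add: polar_norm)
  also have "\<dots> = (\<integral>\<^sup>+r. \<integral>\<^sup>+t. ennreal (\<bar>r\<bar> * exp (- (r\<^sup>2 + a\<^sup>2) / 2) / (2 * pi)) * h (V / 2 * r\<^sup>2) *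
      ennreal (exp (a * r / sqrt (1 + t\<^sup>2)) / (1 + t\<^sup>2)) \<partial>lborel \<partial>lborel)"
  proof (intro nn_integral_cong)
    fix r t :: real
    let ?x = "r / sqrt (1 + t\<^sup>2)" and ?y = "r * t / sqrt (1 + t\<^sup>2)"
    define q where "q = a * r / sqrt (1 + t\<^sup>2)"
    \<comment> \<open>Of the squared distance to the mean only the cross term q depends on the
      angle.\<close>
    have "(?x - a)\<^sup>2 + ?y\<^sup>2 = (?x\<^sup>2 + ?y\<^sup>2) + a\<^sup>2 - 2 * q"
      by (simp add: power2_diff q_def)
    then have "- (((?x - a)\<^sup>2 + ?y\<^sup>2) / 2) = - (r\<^sup>2 + a\<^sup>2) / 2 + q"
      unfolding polar_norm by (simp only:) (simp add: field_simps)
    then have k: "?k ?x ?y = exp (- (r\<^sup>2 + a\<^sup>2) / 2) * exp (a * r / sqrt (1 + t\<^sup>2)) / (2 * pi)"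
      by (simp only: exp_add q_def)
    have "ennreal (\<bar>r\<bar> / (1 + t\<^sup>2)) * ennreal (?k ?x ?y) =
      ennreal (\<bar>r\<bar> * exp (- (r\<^sup>2 + a\<^sup>2) / 2) / (2 * pi)) * ennreal (exp (a * r / sqrt (1 + t\<^sup>2)) / (1 + t\<^sup>2))"
      unfolding k by (subst (1 2) ennreal_mult'[symmetric]) (simp_all add: field_simps)
    from arg_cong[OF this, of "\<lambda>v. v * h (V / 2 * r\<^sup>2)"]
    show "ennreal (\<bar>r\<bar> / (1 + t\<^sup>2)) * (ennreal (?k ?x ?y) * h (V / 2 * r\<^sup>2)) =
      ennreal (\<bar>r\<bar> * exp (- (r\<^sup>2 + a\<^sup>2) / 2) / (2 * pi)) * h (V / 2 * r\<^sup>2) *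
      ennreal (exp (a * r / sqrt (1 + t\<^sup>2)) / (1 + t\<^sup>2))"
      by (simp only: mult_ac)
  qed
  \<comment> \<open>The weight is even in r, so folding changes only the sign in the exponential;
    the two slope integrals are then the two halves of \<open>nn_integral_bessel_I0\<close>.\<close>
  also have "\<dots> = (\<integral>\<^sup>+r. (ennreal (\<bar>r\<bar> * exp (- (r\<^sup>2 + a\<^sup>2) / 2) / (2 * pi)) * h (V / 2 * r\<^sup>2) *
       (\<integral>\<^sup>+t. ennreal (exp (a * r / sqrt (1 + t\<^sup>2)) / (1 + t\<^sup>2)) \<partial>lborel) +
      ennreal (\<bar>r\<bar> * exp (- (r\<^sup>2 + a\<^sup>2) / 2) / (2 * pi)) * h (V / 2 * r\<^sup>2) *
       (\<integral>\<^sup>+t. ennreal (exp (- (a * r / sqrt (1 + t\<^sup>2))) / (1 + t\<^sup>2)) \<partial>lborel)) * indicator {0..} r \<partial>lborel)"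
    by (subst nn_integral_lborel_fold) (simp_all add: nn_integral_cmult)
  also have "\<dots> = (\<integral>\<^sup>+r. ennreal (r * exp (- (r\<^sup>2 + a\<^sup>2) / 2) * bessel_I0 (a * r)) * h (V / 2 * r\<^sup>2) * indicator {0..} r \<partial>lborel)"
  proof (rule nn_integral_cong)
    fix r :: real
    let ?A = "\<bar>r\<bar> * exp (- (r\<^sup>2 + a\<^sup>2) / 2) / (2 * pi)"
    have "(\<integral>\<^sup>+t. ennreal (exp (a * r / sqrt (1 + t\<^sup>2)) / (1 + t\<^sup>2)) \<partial>lborel) +
       (\<integral>\<^sup>+t. ennreal (exp (- (a * r / sqrt (1 + t\<^sup>2))) / (1 + t\<^sup>2)) \<partial>lborel) = ennreal (2 * pi * bessel_I0 (a * r))"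
      by (subst nn_integral_add[symmetric])
         (simp_all add: nn_integral_bessel_I0[symmetric] add_divide_distrib ennreal_plus[symmetric] del: ennreal_plus)
    moreover have "ennreal ?A * ennreal (2 * pi * bessel_I0 (a * r)) =
        ennreal (\<bar>r\<bar> * exp (- (r\<^sup>2 + a\<^sup>2) / 2) * bessel_I0 (a * r))"
      by (subst ennreal_mult'[symmetric]) (simp_all add: mult.assoc)
    ultimately show "(ennreal ?A * h (V / 2 * r\<^sup>2) * (\<integral>\<^sup>+t. ennreal (exp (a * r / sqrt (1 + t\<^sup>2)) / (1 + t\<^sup>2)) \<partial>lborel) +
      ennreal ?A * h (V / 2 * r\<^sup>2) * (\<integral>\<^sup>+t. ennreal (exp (- (a * r / sqrt (1 + t\<^sup>2))) / (1 + t\<^sup>2)) \<partial>lborel)) * indicator {0..} r =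
      ennreal (r * exp (- (r\<^sup>2 + a\<^sup>2) / 2) * bessel_I0 (a * r)) * h (V / 2 * r\<^sup>2) * indicator {0..} r"
      by (simp only: distrib_left[symmetric])
         (auto split: split_indicator simp: mult.commute[of _ "h _"] mult.assoc)
  qed
  finally show ?thesis .
qed

lemma marcum_Q1_nonneg: "b \<ge> 0 \<Longrightarrow> marcum_Q1 a b \<ge> 0"
  unfolding marcum_Q1_def set_lebesgue_integral_def
  by (intro Bochner_Integration.integral_nonneg) (auto split: split_indicator simp: bessel_I0_nonneg)

lemma measurable_marcum_Q1[measurable]:
  assumes [measurable]: "f \<in> borel_measurable M" "g \<in> borel_measurable M"
  shows "(\<lambda>x. marcum_Q1 (f x) (g x)) \<in> borel_measurable M"
proof -
  \<comment> \<open>The domain of integration moves with x; as a condition inside the integrand it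
    becomes jointly measurable in x and t.\<close>
  have "(\<lambda>x. marcum_Q1 (f x) (g x)) =
    (\<lambda>x. LINT t|lborel. (if g x \<le> t then t * exp (- (t\<^sup>2 + (f x)\<^sup>2) / 2) * bessel_I0 (f x * t) else 0))"
    unfolding marcum_Q1_def set_lebesgue_integral_def
    by (intro ext Bochner_Integration.integral_cong) auto
  then show ?thesis by simp
qed

lemma nn_integral_rice_tail:
  assumes V: "V > 0" and w: "w \<ge> 0" and c: "c > 0"
  shows "(\<integral>\<^sup>+z. indicator {c<..} ((cmod (of_real w + of_real (sqrt V) * z))\<^sup>2) \<partial>std_complex_normal) =
    ennreal (marcum_Q1 (sqrt (2 * w\<^sup>2 / V)) (sqrt (2 * c / V)))" (is "?L = _")
proof -
  define a b where "a = sqrt (2 * w\<^sup>2 / V)" and "b = sqrt (2 * c / V)"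
  let ?q = "\<lambda>r. r * exp (- (r\<^sup>2 + a\<^sup>2) / 2) * bessel_I0 (a * r)"
  have b0: "b \<ge> 0" using V c by (simp add: b_def)
  have b: "c < V / 2 * r\<^sup>2 \<longleftrightarrow> b < r" if "r \<ge> 0" for r
  proof -
    have "b < r \<longleftrightarrow> 2 * c / V < r\<^sup>2"
      using that unfolding b_def by (metis real_sqrt_less_iff real_sqrt_unique)
    then show ?thesis using V by (simp add: field_simps)
  qed
  have "?L = (\<integral>\<^sup>+r. ennreal (?q r) * indicator {c<..} (V / 2 * r\<^sup>2) * indicator {0..} r \<partial>lborel)"
    using nn_integral_rice[of "indicator {c<..}" V w] V w by (simp add: a_def)
  also have "\<dots> = (\<integral>\<^sup>+r. ennreal (indicator {b..} r *\<^sub>R ?q r) \<partial>lborel)"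
  \<comment> \<open>The tail event is strict while \<open>marcum_Q1\<close> integrates over a closed
    half-line; they differ at r = b only.\<close>
  proof (intro nn_integral_cong_AE, use AE_lborel_singleton[of b] in eventually_elim)
    fix r assume "r \<noteq> b"
    then show "ennreal (?q r) * indicator {c<..} (V / 2 * r\<^sup>2) * indicator {0..} r = ennreal (indicator {b..} r *\<^sub>R ?q r)"
      using b[of r] b0 by (auto split: split_indicator)
  qed
  finally have L: "?L = \<dots>" .
  have "marcum_Q1 a b = enn2real ?L"
    unfolding marcum_Q1_def set_lebesgue_integral_def L
    using b0 by (intro integral_eq_nn_integral) (auto split: split_indicator simp: bessel_I0_nonneg)
  \<comment> \<open>\<open>enn2real\<close> sends infinity to 0, so the equation for
    \<open>marcum_Q1\<close> can be inverted only once the tail is known to be finite.\<close>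
  moreover have "?L \<le> (\<integral>\<^sup>+z. 1 \<partial>std_complex_normal)"
    by (intro nn_integral_mono) (auto split: split_indicator)
  then have "?L \<le> 1" by (simp add: std_complex_normal.emeasure_space_1)
  then have "?L < top" using ennreal_one_less_top order.strict_trans1 by blast
  ultimately show ?thesis unfolding a_def b_def by simp
qed

section \<open>The joint law of the channel and averaging over G3\<close>

lemma (in prob_space) distr_circular_complex_gaussian:
  assumes "circular_complex_gaussian M G 1" and [measurable]: "random_variable borel G"
  shows "distr M borel G = std_complex_normal"
proof -
  have G: "indep_var borel (\<lambda>w. Re (G w)) borel (\<lambda>w. Im (G w))"
    "distributed M lborel (\<lambda>w. Re (G w)) (\<lambda>x. ennreal (normal_density 0 (sqrt (1 / 2)) x))"
    "distributed M lborel (\<lambda>w. Im (G w)) (\<lambda>x. ennreal (normal_density 0 (sqrt (1 / 2)) x))"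
    using assms(1) unfolding circular_complex_gaussian_def by auto
  have "distr M borel (\<lambda>w. Re (G w)) = half_normal" "distr M borel (\<lambda>w. Im (G w)) = half_normal"
    using G(2,3)[THEN distributed_distr_eq_density]
    by (simp_all add: half_normal_def cong: distr_cong)
  with G(1) have "half_normal \<Otimes>\<^sub>M half_normal = distr M (borel \<Otimes>\<^sub>M borel) (\<lambda>w. (Re (G w), Im (G w)))"
    by (simp add: indep_var_distribution_eq)
  then have "std_complex_normal = distr M borel (\<lambda>w. Complex (Re (G w)) (Im (G w)))"
    unfolding std_complex_normal_def by (simp add: distr_distr comp_def)
  then show ?thesis by simp
qed

context sosf_channel
begin

lemma random_variables[measurable]:
  "random_variable borel \<phi>" "random_variable borel G1" "random_variable borel G2" "random_variable borel G3"
proof -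
  show "random_variable borel \<phi>"
    using distributed_measurable[OF phase_uniform] by simp
  have rv: "random_variable borel ([\<lambda>w. complex_of_real (\<phi> w), G1, G2, G3] ! i)" if "i < 4" for i
    using independent that unfolding indep_vars_def by auto
  show "random_variable borel G1" "random_variable borel G2" "random_variable borel G3"
    using rv[of 1] rv[of 2] rv[of 3] by simp_all
qed

text \<open>G3 is integrated outermost, then the phase: for fixed values of both, the two inner
  integrals see a sum of independent Gaussians around a fixed specular term.\<close>

lemma nn_integral_joint:
  fixes F :: "complex \<times> complex \<times> complex \<times> complex \<Rightarrow> ennreal"
  assumes [measurable]: "F \<in> borel_measurable (borel \<Otimes>\<^sub>M borel \<Otimes>\<^sub>M borel \<Otimes>\<^sub>M borel)"
  shows "(\<integral>\<^sup>+w. F (of_real (\<phi> w), G1 w, G2 w, G3 w) \<partial>M) =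
    (\<integral>\<^sup>+g3. \<integral>\<^sup>+w. \<integral>\<^sup>+g1. \<integral>\<^sup>+g2. F (of_real (\<phi> w), g1, g2, g3) \<partial>std_complex_normal \<partial>std_complex_normal \<partial>M
      \<partial>std_complex_normal)"
proof -
  define X where "X = (\<lambda>i::nat. [\<lambda>w. complex_of_real (\<phi> w), G1, G2, G3] ! i)"
  define P where "P = distr M borel (\<lambda>w. complex_of_real (\<phi> w))"
  \<comment> \<open>\<open>product_sigma_finite\<close> constrains every index, so the family is
    given a probability measure beyond index 3 as well.\<close>
  define D where "D = (\<lambda>i::nat. if i = 0 then P else std_complex_normal)"
  have X: "X 0 = (\<lambda>w. of_real (\<phi> w))" "X 1 = G1" "X 2 = G2" "X 3 = G3"
    by (simp_all add: X_def)
  \<comment> \<open>Indices are split off from the outside of this nested set, and the first one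
    split off becomes the innermost integral; 3 remains as the outermost.\<close>
  have I: "{..<4} = insert (2::nat) (insert 1 (insert 0 {3}))" by auto
  have rv: "random_variable borel (X i)" if "i \<in> {..<4}" for i
    using that unfolding I by (auto simp: X X(2)[unfolded One_nat_def])
  interpret P: prob_space P unfolding P_def by (rule prob_space_distr) simp
  interpret D: product_sigma_finite D
    by (rule product_sigma_finite.intro)
       (simp add: D_def P.sigma_finite_measure_axioms std_complex_normal.sigma_finite_measure_axioms)
  have [measurable_cong, simp]: "sets (D i) = sets borel" for i by (simp add: D_def P_def)
  have "distr M (PiM {..<4} (\<lambda>i. borel)) (\<lambda>w. \<lambda>i\<in>{..<4}. X i w) = PiM {..<4} (\<lambda>i. distr M borel (X i))"
    using independent rv I unfolding X_def[symmetric]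
    by (subst indep_vars_iff_distr_eq_PiM'[symmetric]) auto
  also have "\<dots> = PiM {..<4} D"
    using gaussian[THEN distr_circular_complex_gaussian]
    unfolding I by (intro PiM_cong) (auto simp: X X(2)[unfolded One_nat_def] D_def P_def)
  finally have joint: "PiM {..<4} D = distr M (PiM {..<4} (\<lambda>i. borel)) (\<lambda>w. \<lambda>i\<in>{..<4}. X i w)" ..
  have [measurable]: "(\<lambda>w. \<lambda>i\<in>{..<4}. X i w) \<in> M \<rightarrow>\<^sub>M PiM {..<4} (\<lambda>i. borel)"
    by (intro measurable_restrict rv)
  let ?F = "\<lambda>x. F (x 0, x 1, x 2, x 3)"
  have m[measurable]: "?F \<in> borel_measurable (PiM {..<4} (\<lambda>i::nat. borel))"
    by measurable
  have mD: "?F \<in> borel_measurable (PiM (insert 2 (insert 1 (insert 0 {3}))) D)"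
    by measurable
  have "(\<integral>\<^sup>+w. F (of_real (\<phi> w), G1 w, G2 w, G3 w) \<partial>M) = (\<integral>\<^sup>+x. ?F x \<partial>PiM {..<4} D)"
    unfolding joint by (subst nn_integral_distr) (simp_all add: X X(2)[unfolded One_nat_def])
  also have "\<dots> = (\<integral>\<^sup>+x. \<integral>\<^sup>+p. \<integral>\<^sup>+g1. \<integral>\<^sup>+g2. F (p, g1, g2, x 3) \<partial>D 2 \<partial>D 1 \<partial>D 0 \<partial>PiM {3} D)"
    unfolding I
    by (subst D.product_nn_integral_insert; (measurable | simp))+
  also have "\<dots> = (\<integral>\<^sup>+g3. \<integral>\<^sup>+p. \<integral>\<^sup>+g1. \<integral>\<^sup>+g2. F (p, g1, g2, g3) \<partial>D 2 \<partial>D 1 \<partial>D 0 \<partial>D 3)"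
    by (rule D.product_nn_integral_singleton) measurable
  also have "\<dots> = (\<integral>\<^sup>+g3. \<integral>\<^sup>+w. \<integral>\<^sup>+g1. \<integral>\<^sup>+g2. F (of_real (\<phi> w), g1, g2, g3) \<partial>std_complex_normal \<partial>std_complex_normal \<partial>M
      \<partial>std_complex_normal)"
    by (simp add: D_def P_def nn_integral_distr)
  finally show ?thesis .
qed

lemma nn_integral_sosf:
  fixes h :: "real \<Rightarrow> ennreal"
  assumes [measurable]: "h \<in> borel_measurable borel"
  shows "(\<integral>\<^sup>+w. h ((cmod (sosf_S \<omega>0 \<omega>1 \<omega>2 \<phi> G1 G2 G3 w))\<^sup>2) \<partial>M) =
    (\<integral>\<^sup>+x. ennreal (exponential_density 1 x) *
      (\<integral>\<^sup>+z. h ((cmod (of_real \<omega>0 + of_real (sqrt (\<omega>1\<^sup>2 + \<omega>2\<^sup>2 * x)) * z))\<^sup>2) \<partial>std_complex_normal) \<partial>lborel)"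
proof -
  let ?K = "\<lambda>V. \<integral>\<^sup>+z. h ((cmod (of_real \<omega>0 + of_real (sqrt V) * z))\<^sup>2) \<partial>std_complex_normal"
  let ?S = "\<lambda>(p, g1, g2, g3). of_real \<omega>0 * exp (\<i> * p) + of_real \<omega>1 * g1 + of_real \<omega>2 * g2 * g3"
  have "(\<integral>\<^sup>+w. h ((cmod (sosf_S \<omega>0 \<omega>1 \<omega>2 \<phi> G1 G2 G3 w))\<^sup>2) \<partial>M) =
    (\<integral>\<^sup>+g3. \<integral>\<^sup>+w. \<integral>\<^sup>+g1. \<integral>\<^sup>+g2. h ((cmod (?S (of_real (\<phi> w), g1, g2, g3)))\<^sup>2)
      \<partial>std_complex_normal \<partial>std_complex_normal \<partial>M \<partial>std_complex_normal)"
    using nn_integral_joint[of "\<lambda>x. h ((cmod (?S x))\<^sup>2)"]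
    by (simp add: sosf_S_def case_prod_beta')
  also have "\<dots> = (\<integral>\<^sup>+g3. \<integral>\<^sup>+w. ?K (\<omega>1\<^sup>2 + \<omega>2\<^sup>2 * (cmod g3)\<^sup>2) \<partial>M \<partial>std_complex_normal)"
  proof (rule nn_integral_cong, rule nn_integral_cong)
    fix g3 w
    define u where "u = exp (\<i> * of_real (\<phi> w))"
    define V where "V = \<omega>1\<^sup>2 + \<omega>2\<^sup>2 * (cmod g3)\<^sup>2"
    have u: "cmod u = 1" by (simp add: u_def)
    let ?f = "\<lambda>v. h ((cmod (of_real \<omega>0 * u + v))\<^sup>2)"
    have "(\<integral>\<^sup>+g1. \<integral>\<^sup>+g2. h ((cmod (?S (of_real (\<phi> w), g1, g2, g3)))\<^sup>2) \<partial>std_complex_normal \<partial>std_complex_normal) =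
      (\<integral>\<^sup>+g1. \<integral>\<^sup>+g2. ?f (of_real \<omega>1 * g1 + (of_real \<omega>2 * g3) * g2) \<partial>std_complex_normal \<partial>std_complex_normal)"
      by (simp add: u_def mult_ac add_ac)
    also have "\<dots> = (\<integral>\<^sup>+z. ?f (of_real (sqrt V) * z) \<partial>std_complex_normal)"
      by (subst nn_integral_std_complex_normal_add[of ?f])
         (simp_all add: V_def norm_mult power_mult_distrib)
    \<comment> \<open>Circular symmetry is used backwards: the phase u is inserted into the diffuse
      part, so that it factors out of the whole sum and disappears in the modulus.\<close>
    also have "\<dots> = (\<integral>\<^sup>+z. ?f (of_real (sqrt V) * (u * z)) \<partial>std_complex_normal)"
      by (rule nn_integral_std_complex_normal_rotate[OF _ u, symmetric]) measurable
    also have "\<dots> = ?K V"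
    proof -
      have "of_real \<omega>0 * u + of_real (sqrt V) * (u * z) = u * (of_real \<omega>0 + of_real (sqrt V) * z)" for z
        by (simp add: algebra_simps)
      then show ?thesis using u by (simp only: norm_mult) simp
    qed
    finally show "(\<integral>\<^sup>+g1. \<integral>\<^sup>+g2. h ((cmod (?S (of_real (\<phi> w), g1, g2, g3)))\<^sup>2) \<partial>std_complex_normal \<partial>std_complex_normal) = ?K V" .
  qed
  \<comment> \<open>The integrand is now constant in the sample point and \<open>M\<close> has mass
    1.\<close>
  also have "\<dots> = (\<integral>\<^sup>+g3. ?K (\<omega>1\<^sup>2 + \<omega>2\<^sup>2 * (cmod g3)\<^sup>2) \<partial>std_complex_normal)"
    by (simp add: emeasure_space_1)
  also have "\<dots> = (\<integral>\<^sup>+x. ennreal (exponential_density 1 x) * ?K (\<omega>1\<^sup>2 + \<omega>2\<^sup>2 * x) \<partial>lborel)"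
    by (rule distributed_nn_integral[OF std_complex_normal_norm_exponential, symmetric]) measurable
  finally show ?thesis .
qed

lemma prob_sosf_tail:
  assumes nondegenerate: "\<omega>1 \<noteq> 0 \<or> \<omega>2 \<noteq> 0" and c: "c > 0"
  shows "prob {w \<in> space M. c < (cmod (sosf_S \<omega>0 \<omega>1 \<omega>2 \<phi> G1 G2 G3 w))\<^sup>2} =
    (LBINT x:{0..}. marcum_Q1 (sqrt (2 * \<omega>0\<^sup>2 / (\<omega>1\<^sup>2 + \<omega>2\<^sup>2 * x))) (sqrt (2 * c / (\<omega>1\<^sup>2 + \<omega>2\<^sup>2 * x))) * exp (- x))"
proof -
  let ?V = "\<lambda>x. \<omega>1\<^sup>2 + \<omega>2\<^sup>2 * x" and ?S = "sosf_S \<omega>0 \<omega>1 \<omega>2 \<phi> G1 G2 G3"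
  let ?Q = "\<lambda>x. marcum_Q1 (sqrt (2 * \<omega>0\<^sup>2 / ?V x)) (sqrt (2 * c / ?V x))"
  have [measurable]: "?S \<in> borel_measurable M" unfolding sosf_S_def by measurable
  have Q: "?Q x \<ge> 0" if "x \<ge> 0" for x
    using that c by (intro marcum_Q1_nonneg) auto
  have "emeasure M {w \<in> space M. c < (cmod (?S w))\<^sup>2} = (\<integral>\<^sup>+w. indicator {w \<in> space M. c < (cmod (?S w))\<^sup>2} w \<partial>M)"
    by (rule nn_integral_indicator[symmetric]) measurable
  also have "\<dots> = (\<integral>\<^sup>+w. indicator {c<..} ((cmod (?S w))\<^sup>2) \<partial>M)"
    by (intro nn_integral_cong) (auto split: split_indicator)
  also have "\<dots> = (\<integral>\<^sup>+x. ennreal (exponential_density 1 x) *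
      (\<integral>\<^sup>+z. indicator {c<..} ((cmod (of_real \<omega>0 + of_real (sqrt (?V x)) * z))\<^sup>2) \<partial>std_complex_normal) \<partial>lborel)"
    by (rule nn_integral_sosf) measurable
  also have "\<dots> = (\<integral>\<^sup>+x. ennreal (indicator {0..} x *\<^sub>R (?Q x * exp (- x))) \<partial>lborel)"
  \<comment> \<open>At x = 0 the conditional variance is \<omega>1^2, possibly zero, and the Rice
    tail requires it positive. For x > 0 nondegeneracy guarantees this; for x < 0 both sides
    vanish.\<close>
  proof (intro nn_integral_cong_AE, use AE_lborel_singleton[of "0::real"] in eventually_elim)
    fix x :: real assume x: "x \<noteq> 0"
    show "ennreal (exponential_density 1 x) *
      (\<integral>\<^sup>+z. indicator {c<..} ((cmod (of_real \<omega>0 + of_real (sqrt (?V x)) * z))\<^sup>2) \<partial>std_complex_normal) =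
      ennreal (indicator {0..} x *\<^sub>R (?Q x * exp (- x)))"
    proof (cases "x < 0")
      case False
      with x have "x > 0" by simp
      then have V: "?V x > 0"
        using nondegenerate by (auto intro: add_pos_nonneg add_nonneg_pos)
      show ?thesis
        unfolding nn_integral_rice_tail[OF V nonneg(1) c] using False Q[of x]
        by (simp add: exponential_density_def ennreal_mult'[symmetric] mult.commute)
    qed (simp add: exponential_density_def)
  qed
  finally have "prob {w \<in> space M. c < (cmod (?S w))\<^sup>2} = enn2real (\<integral>\<^sup>+x. ennreal (indicator {0..} x *\<^sub>R (?Q x * exp (- x))) \<partial>lborel)"
    by (simp add: measure_def)
  also have "\<dots> = (LBINT x:{0..}. ?Q x * exp (- x))"
    unfolding set_lebesgue_integral_def
    by (rule integral_eq_nn_integral[symmetric]) (auto split: split_indicator simp: Q)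
  finally show ?thesis .
qed

end

theorem mainTheorem2:
  fixes M :: "'a measure"
    and \<alpha> \<beta> \<gamma>bar \<gamma> \<omega>0 \<omega>1 \<omega>2 :: real
    and \<phi> :: "'a \<Rightarrow> real"
    and G1 G2 G3 :: "'a \<Rightarrow> complex"
  assumes "\<gamma>bar > 0"
    and "\<alpha> \<ge> 0" and "\<beta> \<ge> 0" and "\<alpha> + \<beta> \<le> 1"
    and nondegenerate: "(\<alpha>, \<beta>) \<noteq> (0, 1)"
    and "sosf_channel M \<omega>0 \<omega>1 \<omega>2 \<phi> G1 G2 G3"
    and "\<alpha> = \<omega>2\<^sup>2" and "\<beta> = \<omega>0\<^sup>2"
    and "\<gamma> > 0"
  shows "cdf (distr M borel (sosf_snr \<gamma>bar \<omega>0 \<omega>1 \<omega>2 \<phi> G1 G2 G3)) \<gamma> =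
    1 - (LBINT x:{0..}.
           marcum_Q1 (sqrt (2 * \<beta> / (1 - \<beta> - \<alpha> * (1 - x))))
                     (sqrt ((2 * \<gamma> / \<gamma>bar) / (1 - \<beta> - \<alpha> * (1 - x))))
           * exp (- x))"
proof -
  interpret sosf_channel M \<omega>0 \<omega>1 \<omega>2 \<phi> G1 G2 G3 by fact
  let ?S = "sosf_S \<omega>0 \<omega>1 \<omega>2 \<phi> G1 G2 G3" and ?snr = "sosf_snr \<gamma>bar \<omega>0 \<omega>1 \<omega>2 \<phi> G1 G2 G3"
  let ?E = "{w \<in> space M. \<gamma> / \<gamma>bar < (cmod (?S w))\<^sup>2}"
  have [measurable]: "?S \<in> borel_measurable M" unfolding sosf_S_def by measurable
  have [measurable]: "?snr \<in> borel_measurable M" unfolding sosf_snr_def by measurable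
  \<comment> \<open>The denominators in the formula are the conditional variance given |G3|^2 =
    x.\<close>
  have V: "1 - \<beta> - \<alpha> * (1 - x) = \<omega>1\<^sup>2 + \<omega>2\<^sup>2 * x" for x
    using normalized assms(7,8) by (simp add: algebra_simps)
  have "\<omega>1 \<noteq> 0 \<or> \<omega>2 \<noteq> 0"
    using nondegenerate normalized assms(7,8) by auto
  have "cdf (distr M borel ?snr) \<gamma> = prob (?snr -` {..\<gamma>} \<inter> space M)"
    unfolding cdf_def by (rule measure_distr) auto
  also have "?snr -` {..\<gamma>} \<inter> space M = space M - ?E"
    using assms(1) by (auto simp: sosf_snr_def field_simps)
  also have "prob (space M - ?E) = 1 - prob ?E"
    by (rule prob_compl) measurable
  also have "prob ?E = (LBINT x:{0..}. marcum_Q1 (sqrt (2 * \<omega>0\<^sup>2 / (\<omega>1\<^sup>2 + \<omega>2\<^sup>2 * x)))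
      (sqrt (2 * (\<gamma> / \<gamma>bar) / (\<omega>1\<^sup>2 + \<omega>2\<^sup>2 * x))) * exp (- x))"
    by (rule prob_sosf_tail) (use \<open>\<omega>1 \<noteq> 0 \<or> \<omega>2 \<noteq> 0\<close> assms(1,9) in auto)
  finally show ?thesis
    unfolding V using assms(8) by simp
qed

end
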